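(* Let $\mathbb{M}$ be the Michael line and let $C_p(\mathbb{M})$ be the space of continuous complex-valued functions on $\mathbb{M}$ with the topology of pointwise convergence. Then $C_p(\mathbb{M})$ does not satisfy $(C_0)$.
   Context: The Michael line $\mathbb{M}$ is the set $\mathbb{R}$ with the topology generated by the usual open sets of $\mathbb{R}$ together with all singletons $\{x\}$ with $x\in\mathbb{P}=\mathbb{R}\setminus\mathbb{Q}$. A (Hausdorff, complex) topological vector space $E$ satisfies $(C_0)$ (the countable intersection property for subspaces) if whenever $(M_i)_{i\in I}$ is a family of closed linear subspaces of $E$ with $\bigcap_{i\in I} M_i=\{0\}$, there is a countable set of indices $I_0\subset I$ such that $\bigcap_{i\in I_0} M_i=\{0\}$. *)

theory Defs
  imports "HOL-Analysis.Analysis" "HOL-Library.Function_Algebras"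
begin

definition michael_line :: "real topology" where
  "michael_line = topology_generated_by ({U. open U} \<union> {{x} |x. x \<notin> \<rat>})"

lemma topspace_michael_line [simp]: "topspace michael_line = UNIV"
  by (auto simp: michael_line_def topology_generated_by_topspace)

text \<open>
  A complex topological vector space is given by a topology on a linear subspace (its
  topspace) of an ambient complex vector space \<open>'v\<close> with scalar multiplication \<open>smul\<close>.
\<close>

locale hausdorff_complex_tvs = vector_space smul
  for smul :: "complex \<Rightarrow> 'v::ab_group_add \<Rightarrow> 'v" +
  fixes T :: "'v topology"
  assumes subspace_topspace: "module.subspace smul (topspace T)"
    and continuous_add: "continuous_map (prod_topology T T) T (\<lambda>(x, y). x + y)"
    and continuous_scale: "continuous_map (prod_topology euclidean T) T (\<lambda>(c, x). smul c x)"
    and Hausdorff: "Hausdorff_space T"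

text \<open>
  The property \<open>(C\<^sub>0)\<close>. Families of closed subspaces are represented by their sets of members,
  which loses nothing since only intersections matter. Intersecting with the topspace makes
  the intersection of the empty family the whole space.
\<close>

definition satisfies_C0 :: "(complex \<Rightarrow> 'v::ab_group_add \<Rightarrow> 'v) \<Rightarrow> 'v topology \<Rightarrow> bool" where
  "satisfies_C0 smul T \<longleftrightarrow>
     (\<forall>\<M>. (\<forall>M\<in>\<M>. module.subspace smul M \<and> closedin T M) \<and> topspace T \<inter> \<Inter>\<M> = {0} \<longrightarrow>
        (\<exists>\<M>\<^sub>0\<subseteq>\<M>. countable \<M>\<^sub>0 \<and> topspace T \<inter> \<Inter>\<M>\<^sub>0 = {0}))"

definition fun_scale :: "complex \<Rightarrow> ('a \<Rightarrow> complex) \<Rightarrow> 'a \<Rightarrow> complex" where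
  "fun_scale c f = (\<lambda>x. c * f x)"

text \<open>
  Functions on \<open>X\<close> are represented by their extensions by zero to the whole type, so that the
  carrier is a linear subspace of the full function space and the subspace topology of the
  product topology is pointwise convergence on \<open>X\<close>.
\<close>

definition Cp :: "'a topology \<Rightarrow> ('a \<Rightarrow> complex) topology" where
  "Cp X = subtopology (product_topology (\<lambda>_. euclidean) UNIV)
     {f. continuous_map X euclidean f \<and> (\<forall>x. x \<notin> topspace X \<longrightarrow> f x = 0)}"

lemma topspace_Cp:
  "topspace (Cp X) = {f. continuous_map X euclidean f \<and> (\<forall>x. x \<notin> topspace X \<longrightarrow> f x = 0)}"
  by (simp add: Cp_def)

lemma vector_space_fun_scale: "vector_space (fun_scale :: complex \<Rightarrow> ('a \<Rightarrow> complex) \<Rightarrow> _)"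
  by unfold_locales (auto simp: fun_scale_def fun_eq_iff algebra_simps)

lemma continuous_map_Cp_eval: "continuous_map (Cp X) euclidean (\<lambda>f. f x)"
  unfolding Cp_def
  by (intro continuous_map_from_subtopology continuous_map_product_projection) simp

lemma continuous_map_into_Cp:
  assumes "\<And>x. continuous_map Y euclidean (\<lambda>y. g y x)"
    and "g ` topspace Y \<subseteq> topspace (Cp X)"
  shows "continuous_map Y (Cp X) g"
  using assms unfolding topspace_Cp
  by (auto simp: Cp_def continuous_map_in_subtopology continuous_map_componentwise_UNIV)

text \<open>In particular \<open>(C\<^sub>0)\<close> is meaningful for \<open>Cp X\<close>.\<close>

lemma hausdorff_complex_tvs_Cp: "hausdorff_complex_tvs fun_scale (Cp (X :: 'a topology))"
proof -
  interpret vector_space "fun_scale :: complex \<Rightarrow> ('a \<Rightarrow> complex) \<Rightarrow> _"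
    by (rule vector_space_fun_scale)
  have add: "f + g \<in> topspace (Cp X)" if "f \<in> topspace (Cp X)" "g \<in> topspace (Cp X)" for f g
    using that by (auto simp: topspace_Cp plus_fun_def intro!: continuous_map_add)
  have scale: "fun_scale c f \<in> topspace (Cp X)" if "f \<in> topspace (Cp X)" for c f
  proof -
    have "continuous_map X euclidean ((*) c \<circ> f)"
      using that by (intro continuous_map_compose[of X euclidean])
        (auto simp: topspace_Cp intro!: continuous_intros)
    then show ?thesis
      using that by (auto simp: topspace_Cp fun_scale_def o_def)
  qed
  show ?thesis
  proof
    show "module.subspace fun_scale (topspace (Cp X))"
      using add scale by (intro subspaceI) (auto simp: topspace_Cp zero_fun_def)
    show "continuous_map (prod_topology (Cp X) (Cp X)) (Cp X) (\<lambda>(f, g). f + g)"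
    proof (rule continuous_map_into_Cp)
      fix x
      have "continuous_map (prod_topology (Cp X) (Cp X)) euclidean (\<lambda>p. fst p x + snd p x)"
        by (intro continuous_map_add
            continuous_map_compose[OF continuous_map_fst continuous_map_Cp_eval, unfolded o_def]
            continuous_map_compose[OF continuous_map_snd continuous_map_Cp_eval, unfolded o_def])
      then show "continuous_map (prod_topology (Cp X) (Cp X)) euclidean
          (\<lambda>p. (case p of (f, g) \<Rightarrow> f + g) x)"
        by (simp add: case_prod_unfold)
    qed (use add in auto)
    show "continuous_map (prod_topology euclidean (Cp X)) (Cp X) (\<lambda>(c, f). fun_scale c f)"
    proof (rule continuous_map_into_Cp)
      fix x
      have "continuous_map (prod_topology euclidean (Cp X)) (prod_topology euclidean euclidean)
          (\<lambda>p. (fst p, snd p x))"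
        by (intro continuous_map_pairedI continuous_map_fst
            continuous_map_compose[OF continuous_map_snd continuous_map_Cp_eval, unfolded o_def])
      moreover have "continuous_map (prod_topology euclidean euclidean) euclidean
          (\<lambda>q :: complex \<times> complex. fst q * snd q)"
        by (auto simp: euclidean_product_topology[symmetric] intro!: continuous_intros)
      ultimately have "continuous_map (prod_topology euclidean (Cp X)) euclidean
          ((\<lambda>q :: complex \<times> complex. fst q * snd q) \<circ> (\<lambda>p. (fst p, snd p x)))"
        by (rule continuous_map_compose)
      then show "continuous_map (prod_topology euclidean (Cp X)) euclidean
          (\<lambda>p. (case p of (c, f) \<Rightarrow> fun_scale c f) x)"
        by (simp add: case_prod_unfold fun_scale_def o_def)
    qed (use scale in auto)
    show "Hausdorff_space (Cp X)"
      unfolding Cp_def by (intro Hausdorff_space_subtopology) (simp add: Hausdorff_space_product_topology)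
  qed
qed

end

theory Submission
  imports Defs
begin

text \<open>
  The kernels of the point evaluations on \<open>Cp X\<close> are closed subspaces with zero intersection.
  If \<open>\<delta>\<^sub>a\<close>, the indicator function of \<open>{a}\<close>, is continuous, it lies in the kernel of evaluation
  at every point except \<open>a\<close>, so a subfamily with zero intersection must still contain the kernel
  at \<open>a\<close>. Hence \<open>(C\<^sub>0)\<close> fails as soon as this happens for uncountably many \<open>a\<close>. On the Michael
  line the irrationals are such points: each of them is isolated by construction, and points
  are closed because the topology refines the Hausdorff topology of the real line.
\<close>

definition eval_kernel :: "'a topology \<Rightarrow> 'a \<Rightarrow> ('a \<Rightarrow> complex) set" where
  "eval_kernel X x = {f \<in> topspace (Cp X). f x = 0}"

lemma subspace_eval_kernel: "module.subspace fun_scale (eval_kernel X x)"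
proof -
  interpret hausdorff_complex_tvs fun_scale "Cp X"
    by (rule hausdorff_complex_tvs_Cp)
  show ?thesis
    using subspace_topspace
    by (auto simp: eval_kernel_def subspace_def fun_scale_def)
qed

lemma closedin_eval_kernel: "closedin (Cp X) (eval_kernel X x)"
  using closedin_continuous_map_preimage[OF continuous_map_Cp_eval, of "{0}" X x]
  by (simp add: eval_kernel_def)

lemma Inter_eval_kernels: "topspace (Cp X) \<inter> (\<Inter>x\<in>topspace X. eval_kernel X x) = {0}"
proof -
  interpret hausdorff_complex_tvs fun_scale "Cp X"
    by (rule hausdorff_complex_tvs_Cp)
  have "0 \<in> topspace (Cp X)"
    using subspace_0[OF subspace_topspace] .
  moreover have "f = 0" if "f \<in> topspace (Cp X)" "\<forall>x\<in>topspace X. f x = 0" for f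
    using that unfolding topspace_Cp by (intro ext) auto
  ultimately show ?thesis
    unfolding eval_kernel_def by auto
qed

lemma indicator_clopen_in_Cp:
  assumes "openin X A" "closedin X A"
  shows "indicator A \<in> topspace (Cp X)"
proof -
  have "openin X {x \<in> topspace X. (indicator A x :: complex) \<in> U}" for U
  proof -
    have "{x \<in> topspace X. (indicator A x :: complex) \<in> U} =
        (if 1 \<in> U then A else {}) \<union> (if 0 \<in> U then topspace X - A else {})"
      using openin_subset[OF assms(1)] by (auto simp: indicator_def split: if_splits)
    then show ?thesis
      using assms by auto
  qed
  then show ?thesis
    using openin_subset[OF assms(1)]
    by (auto simp: topspace_Cp continuous_map_def indicator_def)
qed

text \<open>
  A countable subfamily of the evaluation kernels misses the kernel at some clopen point \<open>a\<close>,
  and the indicator function of \<open>{a}\<close> then survives in its intersection.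
\<close>

lemma not_satisfies_C0_Cp_if_uncountable_clopen_points:
  assumes uncountable: "uncountable A"
    and clopen: "\<And>a. a \<in> A \<Longrightarrow> openin X {a} \<and> closedin X {a}"
  shows "\<not> satisfies_C0 fun_scale (Cp X)"
proof
  assume "satisfies_C0 fun_scale (Cp X)"
  moreover have "\<forall>M\<in>eval_kernel X ` topspace X. module.subspace fun_scale M \<and> closedin (Cp X) M"
    by (simp add: subspace_eval_kernel closedin_eval_kernel)
  ultimately obtain \<M>\<^sub>0 where \<M>\<^sub>0: "\<M>\<^sub>0 \<subseteq> eval_kernel X ` topspace X" "countable \<M>\<^sub>0"
      "topspace (Cp X) \<inter> \<Inter>\<M>\<^sub>0 = {0}"
    unfolding satisfies_C0_def using Inter_eval_kernels[of X] by meson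
  obtain C where C: "countable C" "\<M>\<^sub>0 = eval_kernel X ` C"
    using \<M>\<^sub>0(1,2) countable_subset_image by metis
  have "\<not> A \<subseteq> C"
    using uncountable countable_subset[OF _ C(1)] by metis
  then obtain a where a: "a \<in> A" "a \<notin> C"
    by blast
  have "indicator {a} \<in> topspace (Cp X)"
    using clopen[OF a(1)] by (intro indicator_clopen_in_Cp) auto
  moreover have "indicator {a} x = (0 :: complex)" if "x \<in> C" for x
    using that a(2) by (auto simp: indicator_def)
  ultimately have "indicator {a} \<in> topspace (Cp X) \<inter> \<Inter>\<M>\<^sub>0"
    by (auto simp: C(2) eval_kernel_def)
  then have "indicator {a} = (0 :: 'a \<Rightarrow> complex)"
    using \<M>\<^sub>0(3) by blast
  from fun_cong[OF this, of a] show False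
    by simp
qed

lemma openin_michael_line_open: "open U \<Longrightarrow> openin michael_line U"
  unfolding michael_line_def by (rule topology_generated_by_Basis) simp

lemma openin_michael_line_irrational: "x \<notin> \<rat> \<Longrightarrow> openin michael_line {x}"
  unfolding michael_line_def by (rule topology_generated_by_Basis) blast

lemma closedin_michael_line_singleton: "closedin michael_line {x}"
proof -
  have "openin michael_line (- {x})"
    by (intro openin_michael_line_open open_Compl closed_singleton)
  then show ?thesis
    by (simp add: closedin_def Compl_eq_Diff_UNIV)
qed

theorem proposition2p1:
  "\<not> satisfies_C0 fun_scale (Cp michael_line)"
proof (rule not_satisfies_C0_Cp_if_uncountable_clopen_points)
  show "uncountable (UNIV - \<rat> :: real set)"
    using uncountable_minus_countable[OF uncountable_UNIV_real countable_rat] .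
qed (auto intro: openin_michael_line_irrational closedin_michael_line_singleton)

end
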